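(* For all graphs $G$ and $H$ (finite, simple, with at least one vertex), we have $$\gamma(G\square H)\ge \max\left\{\frac{3\gamma(G)-\rho^{\{2\}}(G)}{4}\gamma(H),\ \frac{3\gamma(H)-\rho^{\{2\}}(H)}{4}\gamma(G)\right\}.$$
   Context: All graphs are simple, finite and have at least one vertex. For a graph $G$, the closed neighborhood $N_G[v]$ of a vertex $v\in V(G)$ is the set consisting of $v$ and all its neighbors. The domination number $\gamma(G)$ is the minimum size of a set $D\subseteq V(G)$ such that $N_G[v]\cap D\neq\emptyset$ for every $v\in V(G)$. The Cartesian product $G\square H$ is the graph with vertex set $V(G)\times V(H)$ in which two distinct vertices $(g,h)$ and $(g',h')$ are adjacent if and only if either $gg'\in E(G)$ and $h=h'$, or $g=g'$ and $hh'\in E(H)$. A function $f:V(G)\rightarrow \mathbb{Z}_{\ge 0}$ is called a $2$-packing function if $\sum_{x\in N_G[v]}f(x)\le 2$ for every $v\in V(G)$; $\rho^{\{2\}}(G)$ denotes the maximum of $\sum_{x\in V(G)}f(x)$ over all $2$-packing functions $f$ on $G$. *)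

theory Defs
  imports Complex_Main "Graph_Theory.Pair_Digraph"
begin

text \<open>
  Finite simple graphs are the \<^locale>\<open>pair_graph\<close>s of the AFP entry Graph_Theory: an undirected
  edge \<open>uv\<close> is represented by the two arcs \<open>(u, v)\<close> and \<open>(v, u)\<close>. The locale admits the null
  graph, so \<open>pverts G \<noteq> {}\<close> has to be assumed separately.
\<close>

definition closed_nbhd :: "'a pair_pre_digraph \<Rightarrow> 'a \<Rightarrow> 'a set" where
  "closed_nbhd G v = insert v {u. (v, u) \<in> parcs G}"

definition dominating_set :: "'a pair_pre_digraph \<Rightarrow> 'a set \<Rightarrow> bool" where
  "dominating_set G D \<longleftrightarrow> D \<subseteq> pverts G \<and> (\<forall>v \<in> pverts G. closed_nbhd G v \<inter> D \<noteq> {})"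

definition domination_number :: "'a pair_pre_digraph \<Rightarrow> nat" where
  "domination_number G = Min {card D | D. dominating_set G D}"

definition cartesian_product ::
  "'a pair_pre_digraph \<Rightarrow> 'b pair_pre_digraph \<Rightarrow> ('a \<times> 'b) pair_pre_digraph" where
  "cartesian_product G H =
    \<lparr> pverts = pverts G \<times> pverts H,
      parcs = {((g, h), (g', h')) | g h g' h'.
        (g, h) \<in> pverts G \<times> pverts H \<and> (g', h') \<in> pverts G \<times> pverts H \<and>
        ((g, g') \<in> parcs G \<and> h = h' \<or> g = g' \<and> (h, h') \<in> parcs H)} \<rparr>"

text \<open>
  A function on the vertex set is rendered as a total function whose values outside
  \<open>pverts G\<close> are irrelevant: in a graph, closed neighbourhoods of vertices lie in \<open>pverts G\<close>.
\<close>

definition two_packing_fun :: "'a pair_pre_digraph \<Rightarrow> ('a \<Rightarrow> nat) \<Rightarrow> bool" where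
  "two_packing_fun G f \<longleftrightarrow> (\<forall>v \<in> pverts G. (\<Sum>x \<in> closed_nbhd G v. f x) \<le> 2)"

definition two_packing_number :: "'a pair_pre_digraph \<Rightarrow> nat" where
  "two_packing_number G = Max {(\<Sum>x \<in> pverts G. f x) | f. two_packing_fun G f}"

text \<open>\<^const>\<open>Min\<close> and \<^const>\<open>Max\<close> are unspecified on empty and on infinite sets; on graphs the
  sets above are neither.\<close>

lemma closed_nbhd_subset:
  assumes "pair_graph G" "v \<in> pverts G"
  shows "closed_nbhd G v \<subseteq> pverts G"
proof -
  interpret pair_graph G by fact
  show ?thesis using assms(2) by (auto simp: closed_nbhd_def dest: in_arcsD2)
qed

lemma dominating_set_pverts: "dominating_set G (pverts G)"
  by (auto simp: dominating_set_def closed_nbhd_def)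

lemma finite_dominating_cards:
  assumes "pair_graph G"
  shows "finite {card D | D. dominating_set G D}"
proof -
  interpret pair_graph G by fact
  have "{card D | D. dominating_set G D} \<subseteq> card ` Pow (pverts G)"
    by (auto simp: dominating_set_def)
  then show ?thesis by (rule finite_subset) simp
qed

lemma domination_number_attained:
  assumes "pair_graph G"
  obtains D where "dominating_set G D" "card D = domination_number G"
  using Min_in[OF finite_dominating_cards[OF assms]] dominating_set_pverts[of G]
  unfolding domination_number_def by fastforce

lemma domination_number_le:
  assumes "pair_graph G" "dominating_set G D"
  shows "domination_number G \<le> card D"
  unfolding domination_number_def
  using assms by (intro Min_le finite_dominating_cards) auto

lemma finite_two_packing_sums:
  assumes "pair_graph G"
  shows "finite {(\<Sum>x \<in> pverts G. f x) | f. two_packing_fun G f}"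
proof -
  interpret pair_graph G by fact
  have "sum f (pverts G) \<le> 2 * card (pverts G)" if f: "two_packing_fun G f" for f
  proof -
    have "f x \<le> 2" if x: "x \<in> pverts G" for x
    proof -
      have "finite (closed_nbhd G x)"
        using closed_nbhd_subset[OF assms x] by (rule finite_subset) simp
      then have "f x \<le> sum f (closed_nbhd G x)"
        by (rule member_le_sum[rotated 2]) (auto simp: closed_nbhd_def)
      then show ?thesis using f x by (fastforce simp: two_packing_fun_def)
    qed
    then show ?thesis using sum_bounded_above[of "pverts G" f 2] by (simp add: mult.commute)
  qed
  then show ?thesis by (intro finite_subset[OF _ finite_atMost[of "2 * card (pverts G)"]]) auto
qed

lemma two_packing_number_attained:
  assumes "pair_graph G"
  obtains f where "two_packing_fun G f" "(\<Sum>x \<in> pverts G. f x) = two_packing_number G"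
proof -
  have "two_packing_fun G (\<lambda>_. 0)" by (simp add: two_packing_fun_def)
  then show ?thesis
    using Max_in[OF finite_two_packing_sums[OF assms]] that
    unfolding two_packing_number_def by fastforce
qed

lemma two_packing_number_ge:
  assumes "pair_graph G" "two_packing_fun G f"
  shows "(\<Sum>x \<in> pverts G. f x) \<le> two_packing_number G"
  unfolding two_packing_number_def
  using assms by (intro Max_ge finite_two_packing_sums) auto

lemma pair_graph_cartesian_product:
  assumes "pair_graph G" "pair_graph H"
  shows "pair_graph (cartesian_product G H)"
proof -
  interpret G: pair_graph G by fact
  interpret H: pair_graph H by fact
  have sG: "(v, u) \<in> parcs G" if "(u, v) \<in> parcs G" for u v
    using that G.arcs_symmetric by blast
  have sH: "(v, u) \<in> parcs H" if "(u, v) \<in> parcs H" for u v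
    using that H.arcs_symmetric by blast
  have sub: "parcs (cartesian_product G H) \<subseteq> (pverts G \<times> pverts H) \<times> (pverts G \<times> pverts H)"
    by (auto simp: cartesian_product_def)
  show ?thesis
  proof unfold_locales
    show "finite (parcs (cartesian_product G H))"
      using sub by (rule finite_subset) simp
    show "symmetric (with_proj (cartesian_product G H))"
      by (auto simp: symmetric_def sym_def cartesian_product_def sG sH)
  qed (auto simp: cartesian_product_def dest: G.no_loops' H.no_loops')
qed

end

theory Submission
  imports Defs
begin

text \<open>
  The proof refines the double counting of Clark and Suen. Let \<open>D\<close> dominate \<open>G \<box> H\<close>, let \<open>E\<close> be a
  minimum dominating set of \<open>H\<close>, and let \<open>q\<close> send every vertex of \<open>H\<close> to a vertex of \<open>E\<close> dominating
  it. For \<open>e \<in> E\<close>, let \<open>P e\<close> be the projection to \<open>G\<close> of the part of \<open>D\<close> lying over the cell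
  \<open>q -` {e}\<close>, and let \<open>Q e\<close> be the set of vertices of \<open>G\<close> that \<open>P e\<close> leaves undominated. Two facts
  hold about the sizes of these sets.

  \<^item> The sizes of the \<open>P e\<close> add up to at most \<open>|D|\<close>, and so do those of the \<open>Q e\<close>. For the latter,
    fix \<open>g\<close>: if \<open>g \<in> Q e\<close>, then over \<open>g\<close> the whole cell of \<open>e\<close> is dominated within the \<open>H\<close>-fibre of
    \<open>g\<close>, so the points of \<open>D\<close> in that fibre can replace all those \<open>e\<close> in \<open>E\<close>; as \<open>E\<close> is minimum,
    there are at least as many such points as such \<open>e\<close>.

  \<^item> Together with any set dominating \<open>Q e\<close>, the set \<open>P e\<close> dominates \<open>G\<close>. Clark and Suen use \<open>Q e\<close>
    itself. The saving comes from dominating \<open>Q e\<close> by a set \<open>A e\<close> with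
    \<open>3 |A e| \<le> |Q e| + \<rho>\<close>, where \<open>\<rho>\<close> is the largest weight of a 2-packing function.

  Hence \<open>3 \<gamma>(G) \<le> 3 |P e| + |Q e| + \<rho>\<close> for each \<open>e\<close>, and summation over \<open>E\<close> gives
  \<open>3 \<gamma>(G) \<gamma>(H) \<le> 4 |D| + \<rho> \<gamma>(H)\<close>.

  The set \<open>A e\<close> exists for a reason that concerns arbitrary set systems (lemma
  \<open>cover_le_two_packing\<close>). A member covering at least three points is paid for by these points, so
  it can be put into the cover and its points discarded. Once every member covers at most two of
  the remaining points, covering is a matching problem in the graph whose edges are the pairs
  covered by a common member, and the claim becomes that the fractional vertex cover number of a
  graph is at most \<open>3 / 2\<close> times its matching number (lemma \<open>sparse_cover_le_two_packing\<close>).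
\<close>

section \<open>Covers and 2-packings in set systems\<close>

text \<open>
  Assign each point \<open>x\<close> to a member \<open>p x\<close> containing it, using as few members as possible. The
  classes of \<open>p\<close> then have one or two elements: the pairs form a maximum matching, and the
  singletons are the set \<open>U\<close> of unmatched points. Call two points adjacent if a member contains
  both, and neighbours likewise. Minimality excludes augmenting paths: no two
  points of \<open>U\<close> are adjacent, and the two ends of a pair are never adjacent to two different points
  of \<open>U\<close>. This leaves three kinds of pairs. If neither end has a neighbour in \<open>U\<close>, both ends get
  weight 1. If exactly one has, it gets weight 0 and its partner 1. If both have, their only
  neighbour in \<open>U\<close> is the same point \<open>u\<close>; these three points all get weight 1. The other points
  of \<open>U\<close> get weight 2.

  For the count, each class should carry weight plus cardinality at least 3. Only the points \<open>u\<close>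
  in a triangle fall short, by 1, and each of them is compensated by a pair of its own with
  excess 1.
\<close>
lemma sparse_cover_le_two_packing:
  fixes N :: "'v \<Rightarrow> 'a set"
  assumes fin: "finite R" and cov: "R \<subseteq> (\<Union>v\<in>V. N v)"
    and sparse: "\<And>v. v \<in> V \<Longrightarrow> card (N v \<inter> R) \<le> 2"
  obtains A f where "A \<subseteq> V" "finite A" "R \<subseteq> (\<Union>v\<in>A. N v)"
    "\<And>v. v \<in> V \<Longrightarrow> sum f (N v \<inter> R) \<le> (2::nat)"
    "3 * card A \<le> card R + sum f R"
proof -
  define good where "good p \<longleftrightarrow> (\<forall>x\<in>R. p x \<in> V \<and> x \<in> N (p x))" for p
  have "\<exists>p. good p" unfolding good_def using cov by (intro bchoice) auto
  then obtain p where p: "good p" and pmin: "\<And>p'. good p' \<Longrightarrow> card (p ` R) \<le> card (p' ` R)"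
    using ex_has_least_nat[of good _ "\<lambda>p. card (p ` R)"] by blast
  have pV: "p x \<in> V" and pN: "x \<in> N (p x)" if "x \<in> R" for x
    using p that by (auto simp: good_def)
  define U where "U = {x\<in>R. \<forall>y\<in>R. p y = p x \<longrightarrow> y = x}"
  define adj where "adj x y \<longleftrightarrow> (\<exists>v\<in>V. x \<in> N v \<and> y \<in> N v)" for x y
  define nbU where "nbU x \<longleftrightarrow> (\<exists>u\<in>U. adj u x)" for x
  have UR: "U \<subseteq> R" by (auto simp: U_def)
  have alone: "y = u" if "u \<in> U" "y \<in> R" "p y = p u" for u y
    using that by (auto simp: U_def)
  have adj_sym: "adj x y \<Longrightarrow> adj y x" for x y by (auto simp: adj_def)
  have UU: False if u: "u \<in> U" "u' \<in> U" "u \<noteq> u'" "adj u u'" for u u'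
  proof -
    obtain v where v: "v \<in> V" "u \<in> N v" "u' \<in> N v" using u by (auto simp: adj_def)
    \<comment> \<open>One member covering both points saves one of their two classes.\<close>
    define p' where "p' = p(u := v, u' := v)"
    have "good p'" using v pV pN by (auto simp: good_def p'_def)
    then have "card (p ` R) \<le> card (p' ` R)" by (rule pmin)
    also have "\<dots> \<le> card (insert v (p ` R - {p u, p u'}))"
      using u fin by (intro card_mono) (auto simp: p'_def U_def)
    also have "\<dots> \<le> Suc (card (p ` R - {p u, p u'}))"
      by (rule card_insert_le_m1) auto
    also have "card (p ` R - {p u, p u'}) = card (p ` R) - 2"
    proof -
      have "p u \<noteq> p u'" using u by (auto simp: U_def)
      then show ?thesis using u UR fin by (subst card_Diff_subset) auto
    qed
    finally have "card (p ` R) \<le> Suc (card (p ` R) - 2)" .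
    moreover have "card {p u, p u'} \<le> card (p ` R)"
      using u UR fin by (intro card_mono) auto
    moreover have "card {p u, p u'} = 2" using u by (auto simp: U_def)
    ultimately show False by linarith
  qed
  have aug: "u = u'" if u: "u \<in> U" "u' \<in> U" and r: "r \<in> R" "r' \<in> R" "r \<noteq> r'" "p r = p r'"
    and a: "adj u r" "adj u' r'" for u u' r r'
  proof (rule ccontr)
    assume ne: "u \<noteq> u'"
    obtain v where v: "v \<in> V" "u \<in> N v" "r \<in> N v" using a by (auto simp: adj_def)
    obtain w where w: "w \<in> V" "u' \<in> N w" "r' \<in> N w" using a by (auto simp: adj_def)
    \<comment> \<open>Augmentation along the path \<open>u, r, r', u'\<close>: two classes replace three.\<close>
    define p' where "p' = p(u := v, r := v, u' := w, r' := w)"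
    have "p x \<noteq> p r" if "x \<in> U" for x
      using alone[OF that r(1)] alone[OF that r(2)] r(3,4) by metis
    moreover have "p u \<noteq> p u'" using alone u UR ne by blast
    ultimately have dp: "p u \<noteq> p u'" "p u \<noteq> p r" "p u' \<noteq> p r"
      using u by auto
    have c3: "card {p u, p u', p r} = 3" using dp by auto
    have sub: "{p u, p u', p r} \<subseteq> p ` R" using u(1,2) r(1) UR by blast
    have fibre: "x \<in> {r, r'}" if "x \<in> R" "p x = p r" for x
    proof (rule ccontr)
      assume "x \<notin> {r, r'}"
      then have "card {x, r, r'} = 3" using r by auto
      moreover have "card {x, r, r'} \<le> card (N (p r) \<inter> R)"
        using that r(1,2) fin pN[OF \<open>x \<in> R\<close>] pN[OF r(1)] pN[OF r(2)] r(4)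
        by (intro card_mono) simp_all
      ultimately show False using sparse[OF pV[OF r(1)]] by simp
    qed
    have "good p'" using v w pV pN by (auto simp: good_def p'_def)
    then have "card (p ` R) \<le> card (p' ` R)" by (rule pmin)
    also have "\<dots> \<le> card (insert v (insert w (p ` R - {p u, p u', p r})))"
    proof (intro card_mono subsetI)
      fix z assume "z \<in> p' ` R"
      then obtain x where x: "x \<in> R" "z = p' x" by auto
      show "z \<in> insert v (insert w (p ` R - {p u, p u', p r}))"
      proof (cases "x \<in> {u, u', r, r'}")
        case True
        then show ?thesis using x by (auto simp: p'_def)
      next
        case False
        then have "p x \<noteq> p u" "p x \<noteq> p u'" "p x \<noteq> p r"
          using x alone[OF u(1) x(1)] alone[OF u(2) x(1)] fibre[OF x(1)] by blast+
        then show ?thesis using x False by (auto simp: p'_def)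
      qed
    qed (use fin in auto)
    also have "\<dots> \<le> card (p ` R - {p u, p u', p r}) + 2"
      using fin by (simp add: card_insert_if)
    also have "card (p ` R - {p u, p u', p r}) = card (p ` R) - 3"
      using card_Diff_subset[OF _ sub] c3 by simp
    finally have "card (p ` R) \<le> card (p ` R) - 3 + 2" .
    moreover have "card {p u, p u', p r} \<le> card (p ` R)"
      using fin sub by (intro card_mono) simp_all
    ultimately show False using c3 by linarith
  qed
  define tri where "tri u r r' \<longleftrightarrow> u \<in> U \<and> r \<in> R \<and> r' \<in> R \<and> r \<noteq> r' \<and> p r = p r'
    \<and> adj u r \<and> adj u r'" for u r r'
  define T where "T = {u. \<exists>r r'. tri u r r'}"
  define B where "B = {p r | u r r'. tri u r r'}"
  define f :: "'a \<Rightarrow> nat" where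
    "f x = (if x \<in> U then (if x \<in> T then 1 else 2)
            else if nbU x \<and> (\<forall>y\<in>R. y \<noteq> x \<and> p y = p x \<longrightarrow> \<not> nbU y) then 0 else 1)" for x
  have fibre2: "{x\<in>R. p x = p r} = {r, r'}"
    if r: "r \<in> R" "r' \<in> R" "r \<noteq> r'" "p r = p r'" for r r'
  proof (rule card_seteq[symmetric])
    have "card {x\<in>R. p x = p r} \<le> card (N (p r) \<inter> R)"
      using fin pN by (intro card_mono) force+
    also have "\<dots> \<le> 2" using sparse[OF pV[OF r(1)]] .
    finally show "card {x\<in>R. p x = p r} \<le> card {r, r'}" using r by simp
  qed (use r fin in simp_all)
  have fib_tri: "{x\<in>R. p x = p r} = {r, r'}" if "tri u r r'" for u r r'
    using that unfolding tri_def by (elim conjE) (rule fibre2)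
  have edge: "f x + f y \<le> 2" if e: "x \<in> R" "y \<in> R" "x \<noteq> y" "adj x y" "y \<notin> U" for x y
  proof (cases "x \<in> U")
    case False
    then show ?thesis using e by (auto simp: f_def)
  next
    case True
    show ?thesis
    proof (cases "f y = 0")
      case True
      then show ?thesis by (auto simp: f_def)
    next
      case False
      have "nbU y" using \<open>x \<in> U\<close> e by (auto simp: nbU_def)
      then obtain y' where y': "y' \<in> R" "y' \<noteq> y" "p y' = p y" "nbU y'"
        using False e by (auto simp: f_def split: if_splits)
      then obtain u' where u': "u' \<in> U" "adj u' y'" by (auto simp: nbU_def)
      have "x = u'" using aug[of x u' y y'] u' y' e \<open>x \<in> U\<close> by auto
      then have "tri x y y'" using e y' u' by (auto simp: tri_def)
      then have "x \<in> T" by (auto simp: T_def)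
      then show ?thesis using e \<open>x \<in> U\<close> by (auto simp: f_def)
    qed
  qed
  have pack: "sum f (N v \<inter> R) \<le> 2" if v: "v \<in> V" for v
  proof -
    consider "card (N v \<inter> R) = 0" | "card (N v \<inter> R) = 1" | "card (N v \<inter> R) = 2"
      using sparse[OF v] by linarith
    then show ?thesis
    proof cases
      case 1
      then show ?thesis using fin by simp
    next
      case 2
      then obtain x where "N v \<inter> R = {x}" by (auto simp: card_1_singleton_iff)
      then show ?thesis by (simp add: f_def)
    next
      case 3
      then obtain x y where xy: "N v \<inter> R = {x, y}" "x \<noteq> y" by (auto simp: card_2_iff)
      then have R: "x \<in> R" "y \<in> R" and a: "adj x y" using v by (auto simp: adj_def)
      have "f x + f y \<le> 2"
      proof (cases "y \<in> U")
        case True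
        then have "x \<notin> U" using UU[of x y] xy a by auto
        then show ?thesis using edge[of y x] R xy adj_sym[OF a] by auto
      qed (use edge R xy a in auto)
      then show ?thesis using xy by simp
    qed
  qed
  have finT: "finite T" using fin by (rule finite_subset[rotated]) (use UR in \<open>auto simp: T_def tri_def\<close>)
  have BpR: "B \<subseteq> p ` R" by (auto simp: B_def tri_def)
  \<comment> \<open>A pair lies in a triangle with only one point of \<open>U\<close>, by augmentation, so any choice of a pair
    for each triangle point is injective.\<close>
  have "card T \<le> card B"
  proof -
    have "\<forall>u\<in>T. \<exists>w. \<exists>r r'. tri u r r' \<and> w = p r" by (auto simp: T_def)
    from bchoice[OF this] obtain g where g: "\<forall>u\<in>T. \<exists>r r'. tri u r r' \<and> g u = p r" ..
    have "inj_on g T"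
    proof (rule inj_onI)
      fix u w assume uw: "u \<in> T" "w \<in> T" "g u = g w"
      obtain r r' where r: "tri u r r'" "g u = p r" using g uw by blast
      obtain s s' where s: "tri w s s'" "g w = p s" using g uw by blast
      have "p s = p r" using r s uw by simp
      then have "{r, r'} = {s, s'}" using fib_tri[OF r(1)] fib_tri[OF s(1)] by simp
      then have "adj w r'" using s by (auto simp: tri_def doubleton_eq_iff)
      with r(1) s(1) show "u = w" unfolding tri_def by (elim conjE) (rule aug)
    qed
    moreover have "g ` T \<subseteq> B" unfolding B_def using g by blast
    ultimately show ?thesis
      using card_inj_on_le[of g T B] finite_subset[OF BpR] fin by auto
  qed
  then have "card (p ` T) \<le> card B"
    using card_image_le[OF finT, of p] by linarith
  have TpR: "p ` T \<subseteq> p ` R" using UR by (auto simp: T_def tri_def)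
  have cls: "3 + (if w \<in> B then 1 else 0)
      \<le> (\<Sum>x\<in>{x\<in>R. p x = w}. f x + 1) + (if w \<in> p ` T then 1 else (0::nat))"
    if w: "w \<in> p ` R" for w
  proof (cases "\<exists>u\<in>U. w = p u")
    case True
    then obtain u where u: "u \<in> U" "w = p u" by auto
    then have "{x\<in>R. p x = w} = {u}" using UR alone[OF u(1)] by auto
    moreover have "w \<notin> B"
    proof
      assume "w \<in> B"
      then obtain u' r r' where t: "tri u' r r'" "w = p r" by (auto simp: B_def)
      then show False
        using alone[OF u(1), of r] alone[OF u(1), of r'] u(2) unfolding tri_def by metis
    qed
    moreover have "f u = (if u \<in> T then 1 else 2)" using u by (simp add: f_def)
    ultimately show ?thesis using u by auto
  next
    case False
    obtain r where r: "r \<in> R" "w = p r" using w by auto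
    then have "r \<notin> U" using False by auto
    then obtain r' where r': "r' \<in> R" "r' \<noteq> r" "p r' = p r" using r by (auto simp: U_def)
    have "r' \<notin> U" using False r r' by auto
    have fib: "{x\<in>R. p x = w} = {r, r'}" using fibre2[of r r'] r r' by auto
    have "y \<in> R \<and> p y = p r \<longleftrightarrow> y = r \<or> y = r'" for y
      using fib unfolding r(2) by (auto simp: set_eq_iff)
    then have others: "(\<forall>y\<in>R. y \<noteq> r \<and> p y = p r \<longrightarrow> \<not> nbU y) \<longleftrightarrow> \<not> nbU r'"
      "(\<forall>y\<in>R. y \<noteq> r' \<and> p y = p r' \<longrightarrow> \<not> nbU y) \<longleftrightarrow> \<not> nbU r"
      using r'(2,3) by metis+
    have fr: "f r = (if nbU r \<and> \<not> nbU r' then 0 else 1)"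
      "f r' = (if nbU r' \<and> \<not> nbU r then 0 else 1)"
      unfolding f_def others using \<open>r \<notin> U\<close> \<open>r' \<notin> U\<close> by auto
    have "nbU r \<and> nbU r'" if "w \<in> B"
    proof -
      obtain u s s' where s: "tri u s s'" "w = p s" using \<open>w \<in> B\<close> by (auto simp: B_def)
      then have "{s, s'} = {r, r'}" using fib fib_tri[OF s(1)] by simp
      then have "adj u r" "adj u r'" using s by (auto simp: tri_def doubleton_eq_iff)
      then show ?thesis using s by (auto simp: nbU_def tri_def)
    qed
    then show ?thesis using fr r'(2) by (auto simp: fib)
  qed
  have "3 * card (p ` R) + card B = (\<Sum>w\<in>p ` R. 3 + (if w \<in> B then 1 else 0))"
    using fin BpR by (simp add: sum.distrib sum.If_cases Int_absorb1)
  also have "\<dots> \<le> (\<Sum>w\<in>p ` R. (\<Sum>x\<in>{x\<in>R. p x = w}. f x + 1) + (if w \<in> p ` T then 1 else 0))"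
    by (rule sum_mono) (rule cls)
  also have "\<dots> = (\<Sum>w\<in>p ` R. \<Sum>x\<in>{x\<in>R. p x = w}. f x + 1) + card (p ` T)"
    using fin TpR unfolding sum.distrib[of _ _ "p ` R"] by (simp add: sum.If_cases Int_absorb1)
  also have "(\<Sum>w\<in>p ` R. \<Sum>x\<in>{x\<in>R. p x = w}. f x + 1) = (\<Sum>x\<in>R. f x + 1)"
    using sum.image_gen[OF fin, of "\<lambda>x. f x + 1" p] by simp
  also have "\<dots> = sum f R + card R"
    unfolding sum.distrib by simp
  finally have "3 * card (p ` R) \<le> card R + sum f R"
    using \<open>card (p ` T) \<le> card B\<close> by linarith
  then show thesis
    using that[of "p ` R" f] pV pN fin pack by blast
qed

text \<open>
  Induction on the number of points: a member with at least three of them joins the cover and takes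
  its points with it, until \<open>sparse_cover_le_two_packing\<close> applies. Weights are 0 on the points taken
  away, so the 2-packing condition survives their return.
\<close>
lemma cover_le_two_packing:
  fixes N :: "'v \<Rightarrow> 'a set"
  assumes "finite Q" and "Q \<subseteq> (\<Union>v\<in>V. N v)"
  shows "\<exists>A f. A \<subseteq> V \<and> finite A \<and> Q \<subseteq> (\<Union>v\<in>A. N v)
    \<and> (\<forall>v\<in>V. sum f (N v \<inter> Q) \<le> (2::nat)) \<and> 3 * card A \<le> card Q + sum f Q"
  using assms
proof (induction Q rule: finite_psubset_induct)
  case (psubset Q)
  show ?case
  proof (cases "\<forall>v\<in>V. card (N v \<inter> Q) \<le> 2")
    case True
    then have "\<And>v. v \<in> V \<Longrightarrow> card (N v \<inter> Q) \<le> 2" by blast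
    from sparse_cover_le_two_packing[OF psubset.hyps psubset.prems this]
    obtain A f where "A \<subseteq> V" "finite A" "Q \<subseteq> (\<Union>v\<in>A. N v)"
      "\<And>v. v \<in> V \<Longrightarrow> sum f (N v \<inter> Q) \<le> (2::nat)" "3 * card A \<le> card Q + sum f Q"
      by blast
    then show ?thesis by (intro exI[of _ A] exI[of _ f]) simp
  next
    case False
    then obtain v where v: "v \<in> V" "3 \<le> card (N v \<inter> Q)" by force
    define Q' where "Q' = Q - N v"
    have finQ: "finite Q" by fact
    have "N v \<inter> Q \<noteq> {}" using v(2) by (metis card.empty not_numeral_le_zero)
    then have "Q' \<subset> Q" by (auto simp: Q'_def)
    moreover have "Q' \<subseteq> (\<Union>v\<in>V. N v)" using psubset.prems by (auto simp: Q'_def)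
    ultimately obtain A f where
      A: "A \<subseteq> V" "finite A" "Q' \<subseteq> (\<Union>v\<in>A. N v)" "3 * card A \<le> card Q' + sum f Q'"
      and f: "\<forall>v\<in>V. sum f (N v \<inter> Q') \<le> (2::nat)"
      using psubset.IH[of Q'] by blast
    define f' where "f' x = (if x \<in> Q' then f x else 0)" for x
    have f': "sum f' (X \<inter> Q) = sum f (X \<inter> Q')" for X
      using finQ \<open>Q' \<subset> Q\<close> by (intro sum.mono_neutral_cong_right) (auto simp: f'_def)
    have "3 * card (insert v A) \<le> 3 * card A + 3"
      using A(2) by (simp add: card_insert_if)
    also have "\<dots> \<le> card Q' + card (N v \<inter> Q) + sum f Q'"
      using A(4) v(2) by linarith
    also have "card Q' + card (N v \<inter> Q) = card Q"
    proof -
      have "Q = Q' \<union> (N v \<inter> Q)" by (auto simp: Q'_def)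
      moreover have "Q' \<inter> (N v \<inter> Q) = {}" by (auto simp: Q'_def)
      ultimately show ?thesis
        using card_Un_disjoint[of Q' "N v \<inter> Q"] finQ \<open>Q' \<subset> Q\<close> finite_subset[of Q' Q] by simp
    qed
    also have "sum f Q' = sum f' Q" using f'[of UNIV] by simp
    finally have "3 * card (insert v A) \<le> card Q + sum f' Q" .
    moreover have "Q \<subseteq> (\<Union>v\<in>insert v A. N v)" using A(3) by (auto simp: Q'_def)
    ultimately show ?thesis
      using A(1,2) v(1) f f' by (intro exI[of _ "insert v A"] exI[of _ f']) auto
  qed
qed

section \<open>Domination in graphs\<close>

lemma closed_nbhd_sym:
  assumes "pair_graph G"
  shows "u \<in> closed_nbhd G v \<longleftrightarrow> v \<in> closed_nbhd G u"
proof -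
  interpret pair_graph G by fact
  show ?thesis using arcs_symmetric by (auto simp: closed_nbhd_def)
qed

lemma closed_nbhd_cartesian_product_iff:
  assumes "pair_graph G" "pair_graph H" "g \<in> pverts G" "h \<in> pverts H"
  shows "(g', h') \<in> closed_nbhd (cartesian_product G H) (g, h) \<longleftrightarrow>
    g' \<in> closed_nbhd G g \<and> h' = h \<or> g' = g \<and> h' \<in> closed_nbhd H h"
  using closed_nbhd_subset[OF assms(1,3)] closed_nbhd_subset[OF assms(2,4)] assms(3,4)
  by (auto simp: closed_nbhd_def cartesian_product_def)

text \<open>
  The set system here consists of the closed neighbourhoods; a vertex covers with its closed
  neighbourhood exactly the vertices that it dominates.
\<close>
lemma dominating_subset_two_packing_bound:
  assumes G: "pair_graph G" and Q: "Q \<subseteq> pverts G"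
  obtains A where "A \<subseteq> pverts G" "\<And>x. x \<in> Q \<Longrightarrow> closed_nbhd G x \<inter> A \<noteq> {}"
    "3 * card A \<le> card Q + two_packing_number G"
proof -
  interpret pair_graph G by fact
  have finQ: "finite Q" using Q by (rule finite_subset) simp
  have "Q \<subseteq> (\<Union>v\<in>pverts G. closed_nbhd G v)" using Q by (auto simp: closed_nbhd_def)
  from cover_le_two_packing[OF finQ this] obtain A f where
    A: "A \<subseteq> pverts G" "Q \<subseteq> (\<Union>v\<in>A. closed_nbhd G v)" "3 * card A \<le> card Q + sum f Q"
    and f: "\<And>v. v \<in> pverts G \<Longrightarrow> sum f (closed_nbhd G v \<inter> Q) \<le> (2::nat)"
    by blast
  define f' where "f' x = (if x \<in> Q then f x else 0)" for x
  have f': "sum f' X = sum f (X \<inter> Q)" if "X \<subseteq> pverts G" for X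
    using finite_subset[OF that] by (simp add: f'_def sum.inter_restrict)
  have "two_packing_fun G f'"
    using f f' closed_nbhd_subset[OF G] by (simp add: two_packing_fun_def)
  from two_packing_number_ge[OF G this] have "sum f Q \<le> two_packing_number G"
    using f'[of "pverts G"] Q by (simp add: Int_absorb1)
  then have "3 * card A \<le> card Q + two_packing_number G" using A(3) by linarith
  moreover have "closed_nbhd G x \<inter> A \<noteq> {}" if "x \<in> Q" for x
    using A(2) that closed_nbhd_sym[OF G] by blast
  ultimately show thesis using that A(1) by blast
qed

section \<open>Domination in Cartesian products\<close>

text \<open>
  Four copies of \<open>D\<close> are spent: three when \<open>D\<close> is split along the cells of \<open>E\<close>, which bounds the sets
  \<open>P e\<close>, and one when \<open>D\<close> is split along the \<open>H\<close>-fibres, which bounds the sets \<open>Q e\<close> through a double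
  count of the pairs \<open>(g, e)\<close> with \<open>g \<in> Q e\<close>.
\<close>
lemma dominating_cartesian_product_bound:
  assumes G: "pair_graph G" and H: "pair_graph H"
    and D: "dominating_set (cartesian_product G H) D"
  shows "3 * domination_number G * domination_number H
    \<le> 4 * card D + two_packing_number G * domination_number H"
proof -
  interpret G: pair_graph G by fact
  interpret H: pair_graph H by fact
  have DV: "D \<subseteq> pverts G \<times> pverts H"
    using D by (auto simp: dominating_set_def cartesian_product_def)
  have finD: "finite D" using DV by (rule finite_subset) simp
  obtain E where E: "dominating_set H E" "card E = domination_number H"
    using domination_number_attained[OF H] .
  have EV: "E \<subseteq> pverts H" using E by (simp add: dominating_set_def)
  have finE: "finite E" using EV by (rule finite_subset) simp
  have "\<forall>h\<in>pverts H. \<exists>e. e \<in> E \<and> e \<in> closed_nbhd H h"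
    using E(1) by (auto simp: dominating_set_def)
  from bchoice[OF this] obtain q
    where "\<forall>h\<in>pverts H. q h \<in> E \<and> q h \<in> closed_nbhd H h" ..
  then have q: "\<And>h. h \<in> pverts H \<Longrightarrow> q h \<in> E \<and> q h \<in> closed_nbhd H h" by blast
  define P where "P e = fst ` {x\<in>D. q (snd x) = e}" for e
  define Q where "Q e = {g\<in>pverts G. closed_nbhd G g \<inter> P e = {}}" for e
  have cell: "3 * domination_number G
      \<le> 3 * card {x\<in>D. q (snd x) = e} + card (Q e) + two_packing_number G" for e
  proof -
    have "Q e \<subseteq> pverts G" by (auto simp: Q_def)
    from dominating_subset_two_packing_bound[OF G this] obtain A where
      A: "A \<subseteq> pverts G" "\<And>x. x \<in> Q e \<Longrightarrow> closed_nbhd G x \<inter> A \<noteq> {}"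
        "3 * card A \<le> card (Q e) + two_packing_number G" by blast
    have "dominating_set G (P e \<union> A)"
      using A(1,2) DV by (fastforce simp: dominating_set_def P_def Q_def)
    then have "domination_number G \<le> card (P e \<union> A)" by (rule domination_number_le[OF G])
    also have "\<dots> \<le> card (P e) + card A" by (rule card_Un_le)
    also have "card (P e) \<le> card {x\<in>D. q (snd x) = e}"
      unfolding P_def using finD by (intro card_image_le) simp
    finally show ?thesis using A(3) by linarith
  qed
  have sumP: "(\<Sum>e\<in>E. card {x\<in>D. q (snd x) = e}) = card D"
  proof -
    have "(\<Sum>e\<in>E. \<Sum>x\<in>{x\<in>D. q (snd x) = e}. 1::nat) = (\<Sum>x\<in>D. 1)"
      using finD finE DV q by (intro sum.group) auto
    then show ?thesis by simp
  qed
  have fibre: "card {e\<in>E. g \<in> Q e} \<le> card {x\<in>D. fst x = g}" if g: "g \<in> pverts G" for g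
  proof -
    define S where "S = {e\<in>E. g \<in> Q e}"
    define F where "F = snd ` {x\<in>D. fst x = g}"
    have "dominating_set H (F \<union> (E - S))"
      unfolding dominating_set_def
    proof (intro conjI ballI)
      show "F \<union> (E - S) \<subseteq> pverts H" using EV DV by (auto simp: F_def)
    next
      fix h assume h: "h \<in> pverts H"
      show "closed_nbhd H h \<inter> (F \<union> (E - S)) \<noteq> {}"
      proof (cases "q h \<in> S")
        case False
        then show ?thesis using q[OF h] by auto
      next
        case True
        have "(g, h) \<in> pverts (cartesian_product G H)"
          using g h by (simp add: cartesian_product_def)
        then have "closed_nbhd (cartesian_product G H) (g, h) \<inter> D \<noteq> {}"
          using D by (auto simp: dominating_set_def)
        then obtain g' h' where d: "(g', h') \<in> D"
          and n: "(g', h') \<in> closed_nbhd (cartesian_product G H) (g, h)"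
          by (metis disjoint_iff surj_pair)
        from n consider "g' \<in> closed_nbhd G g" "h' = h" | "g' = g" "h' \<in> closed_nbhd H h"
          unfolding closed_nbhd_cartesian_product_iff[OF G H g h] by blast
        \<comment> \<open>Domination along \<open>G\<close> would put a point of the closed
          neighbourhood of \<open>g\<close> into \<open>P (q h)\<close>, against \<open>g \<in> Q (q h)\<close>.\<close>
        then show ?thesis
        proof cases
          case 1
          then have "g' \<in> P (q h)" using d by (force simp: P_def)
          then show ?thesis using 1 True by (auto simp: S_def Q_def)
        next
          case 2
          then have "h' \<in> F" using d by (force simp: F_def)
          then show ?thesis using 2 by auto
        qed
      qed
    qed
    then have "card E \<le> card (F \<union> (E - S))"
      unfolding E(2) by (rule domination_number_le[OF H])
    also have "\<dots> \<le> card F + card (E - S)" by (rule card_Un_le)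
    also have "card (E - S) = card E - card S"
      using finE by (intro card_Diff_subset) (auto simp: S_def)
    finally have "card E \<le> card F + (card E - card S)" .
    moreover have "card S \<le> card E" using finE by (intro card_mono) (auto simp: S_def)
    moreover have "card F \<le> card {x\<in>D. fst x = g}"
      unfolding F_def using finD by (intro card_image_le) simp
    ultimately show ?thesis by (simp add: S_def)
  qed
  have "(\<Sum>e\<in>E. card (Q e)) = (\<Sum>g\<in>pverts G. card {e\<in>E. g \<in> Q e})"
  proof -
    have "Q e = {g\<in>pverts G. g \<in> Q e}" for e by (auto simp: Q_def)
    then have "(\<Sum>e\<in>E. card (Q e)) = (\<Sum>e\<in>E. \<Sum>g\<in>{g\<in>pverts G. g \<in> Q e}. 1::nat)"
      by simp
    also have "\<dots> = (\<Sum>g\<in>pverts G. \<Sum>e\<in>{e\<in>E. g \<in> Q e}. 1)"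
      using finE by (intro sum.swap_restrict) auto
    finally show ?thesis by simp
  qed
  also have "\<dots> \<le> (\<Sum>g\<in>pverts G. card {x\<in>D. fst x = g})"
    by (rule sum_mono) (rule fibre)
  also have "\<dots> = card D"
  proof -
    have "(\<Sum>g\<in>pverts G. \<Sum>x\<in>{x\<in>D. fst x = g}. 1::nat) = (\<Sum>x\<in>D. 1)"
      using finD DV by (intro sum.group) auto
    then show ?thesis by simp
  qed
  finally have sumQ: "(\<Sum>e\<in>E. card (Q e)) \<le> card D" .
  have "3 * domination_number G * domination_number H = (\<Sum>e\<in>E. 3 * domination_number G)"
    by (simp add: E(2))
  also have "\<dots> \<le> (\<Sum>e\<in>E. 3 * card {x\<in>D. q (snd x) = e} + card (Q e) + two_packing_number G)"
    by (rule sum_mono) (rule cell)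
  also have "\<dots> = 3 * card D + (\<Sum>e\<in>E. card (Q e)) + two_packing_number G * domination_number H"
    by (simp add: sum.distrib sumP E(2) flip: sum_distrib_left)
  finally show ?thesis using sumQ by linarith
qed

lemma dominating_set_cartesian_product_swap:
  assumes G: "pair_graph G" and H: "pair_graph H"
    and D: "dominating_set (cartesian_product G H) D"
  shows "dominating_set (cartesian_product H G) (prod.swap ` D)"
  unfolding dominating_set_def
proof (intro conjI ballI)
  show "prod.swap ` D \<subseteq> pverts (cartesian_product H G)"
    using D by (auto simp: dominating_set_def cartesian_product_def)
next
  fix x assume "x \<in> pverts (cartesian_product H G)"
  then obtain h g where x: "x = (h, g)" "h \<in> pverts H" "g \<in> pverts G"
    by (auto simp: cartesian_product_def)
  then have "(g, h) \<in> pverts (cartesian_product G H)" by (simp add: cartesian_product_def)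
  then have "closed_nbhd (cartesian_product G H) (g, h) \<inter> D \<noteq> {}"
    using D by (auto simp: dominating_set_def)
  then obtain g' h' where d: "(g', h') \<in> D"
    and n: "(g', h') \<in> closed_nbhd (cartesian_product G H) (g, h)"
    by (metis disjoint_iff surj_pair)
  have "(h', g') \<in> closed_nbhd (cartesian_product H G) x"
    using n x by (auto simp: closed_nbhd_cartesian_product_iff[OF G H]
        closed_nbhd_cartesian_product_iff[OF H G])
  moreover have "(h', g') \<in> prod.swap ` D" using d by force
  ultimately show "closed_nbhd (cartesian_product H G) x \<inter> prod.swap ` D \<noteq> {}" by blast
qed

theorem theorem1p4:
  fixes G :: "'a pair_pre_digraph" and H :: "'b pair_pre_digraph"
  assumes "pair_graph G" and "pverts G \<noteq> {}"
    and "pair_graph H" and "pverts H \<noteq> {}"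
  shows "real (domination_number (cartesian_product G H)) \<ge>
    max ((3 * real (domination_number G) - real (two_packing_number G)) / 4
           * real (domination_number H))
        ((3 * real (domination_number H) - real (two_packing_number H)) / 4
           * real (domination_number G))"
proof -
  note G = assms(1) and H = assms(3)
  obtain D where D: "dominating_set (cartesian_product G H) D"
    "card D = domination_number (cartesian_product G H)"
    using domination_number_attained[OF pair_graph_cartesian_product[OF G H]] .
  have "card (prod.swap ` D) = card D" by (simp add: card_image)
  then have "3 * domination_number H * domination_number G
      \<le> 4 * card D + two_packing_number H * domination_number G"
    using dominating_cartesian_product_bound[OF H G
        dominating_set_cartesian_product_swap[OF G H D(1)]] by simp
  from of_nat_mono[where 'a = real, OF this]
    of_nat_mono[where 'a = real, OF dominating_cartesian_product_bound[OF G H D(1)]]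
  show ?thesis unfolding D(2) by (simp add: field_simps)
qed

end
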